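(* Let $x_1,\dots,x_k\in\mathbb{Z}$ be finite and constant (independent of $N$). Let the positive integers $n_1,\dots,n_k$ and the parameters $\gamma^\pm$ depend on $N$ in such a way that $n_j/N\to t_j\in\mathbb{R}_+$ for all $j$ and $\gamma^{\pm}N\to a>0$ (the same limit $a$ for both signs). Then as $N\to\infty$, $$\det[K(n_i,x_i;n_j,x_j)]_{1\le i,j\le k}\to\det[\mathbb{J}(at_i,x_i;at_j,x_j)]_{1\le i,j\le k}.$$
   Context: For parameters $\gamma^\pm\ge 0$, positive integers $n_1,n_2$ and integers $x_1,x_2$, the kernel $K$ (the correlation kernel of the determinantal point process on $\mathbb{Z}_+\times\mathbb{Z}$ attached to the Plancherel measures of $U(\infty)$ with parameters $\gamma^\pm$) is $$K(n_1,x_1;n_2,x_2)=-\mathbf{1}_{n_1<n_2}\frac{1}{2\pi i}\oint\frac{z^{x_1-x_2-1}}{(1-z)^{n_2-n_1}}dz+\left(\frac{1}{2\pi i}\right)^2\oint\oint \frac{e^{\gamma^-u+\gamma^+u^{-1}}u^{x_1}(1-u)^{n_1}}{e^{\gamma^-w+\gamma^+w^{-1}}w^{1+x_2}(1-w)^{n_2}}\frac{du\,dw}{u-w},$$ with $u$ over $|u|=r<1$, $w$ over $|w-1|=\epsilon<1-r$, $z$ over $|z|=r<1$ ($r,\epsilon>0$, counterclockwise). The kernel $\mathbb{J}$ on $\mathbb{R}_+\times\mathbb{Z}$ is $$\mathbb{J}(s,x;t,y)=\left(\frac{1}{2\pi i}\right)^2\oint\oint \frac{e^{u^{-1}-tu-w^{-1}+sw}}{w-u}\frac{du\,dw}{w^{x+1}u^{-y}},$$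 where the $w$- and $u$-contours go counterclockwise around $0$ in such a way that the $w$-contour contains the $u$-contour if $s\ge t$, and the $w$-contour is contained in the $u$-contour if $s<t$.
   Formalization: In J the contour order is corrected: the w-contour is outside if s ≤ t and inside if s > t (as printed, the claim fails for unequal times). If t_i = t_j and x_i = x_j, then n_i = n_j is required for all large N. R_+ is read as t_j > 0. *)

theory Defs
  imports "HOL-Complex_Analysis.Complex_Analysis"
begin

(* The kernel K with parameters gm = gamma^- and gp = gamma^+.  Its value does not depend on the
   radii as long as 0 < r < 1 and 0 < e < 1 - r, the range in which it is used.
   The truncated subtraction n2 - n1 only matters under the guard n1 < n2. *)
definition K_kernel ::
  "real \<Rightarrow> real \<Rightarrow> real \<Rightarrow> real \<Rightarrow> nat \<Rightarrow> int \<Rightarrow> nat \<Rightarrow> int \<Rightarrow> complex" where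
  "K_kernel r e gm gp n1 x1 n2 x2 =
     - (if n1 < n2 then
          1 / (2 * of_real pi * \<i>) *
          contour_integral (circlepath 0 r)
            (\<lambda>z. z powi (x1 - x2 - 1) / (1 - z) ^ (n2 - n1))
        else 0)
     + (1 / (2 * of_real pi * \<i>)) ^ 2 *
       contour_integral (circlepath 1 e) (\<lambda>w.
         contour_integral (circlepath 0 r) (\<lambda>u.
           (exp (of_real gm * u + of_real gp * inverse u) * u powi x1 * (1 - u) ^ n1) /
           (exp (of_real gm * w + of_real gp * inverse w) * w powi (1 + x2) * (1 - w) ^ n2) *
           (1 / (u - w))))"

definition J_integral ::
  "(real \<Rightarrow> complex) \<Rightarrow> (real \<Rightarrow> complex) \<Rightarrow> real \<Rightarrow> int \<Rightarrow> real \<Rightarrow> int \<Rightarrow> complex" where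
  "J_integral U W s x t y =
     (1 / (2 * of_real pi * \<i>)) ^ 2 *
     contour_integral W (\<lambda>w.
       contour_integral U (\<lambda>u.
         exp (inverse u - of_real t * u - inverse w + of_real s * w) / (w - u) *
         (1 / (w powi (x + 1) * u powi (- y)))))"

(* The kernel J.  The contours are the circles about 0 of radii r1 < r2; the value is the same
   for all 0 < r1 < r2.

   Order of the contours: the w-contour is the outer one iff s \<le> t.  The source prints
   "s \<ge> t" (outer) and "s < t" (inner) here, which is incompatible with the kernel K.
   Put u = a u'/N, w = a w'/N in the double integral of K(n1,x1;n2,x2).  It tends, up to the
   conjugating factor (N/a)^(x2-x1), to the integral of J(a t2,x2;a t1,x1) with the w-contour outside;
   the additional term of K, present for n1 < n2, subtracts the residue at w = u and so moves the
   w-contour inside.  Hence w is inside exactly when the first time argument of J exceeds the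
   second.  For s = t both conventions put the w-contour outside. *)
definition J_kernel ::
  "real \<Rightarrow> real \<Rightarrow> real \<Rightarrow> int \<Rightarrow> real \<Rightarrow> int \<Rightarrow> complex" where
  "J_kernel r1 r2 s x t y =
     (if s \<le> t then J_integral (circlepath 0 r1) (circlepath 0 r2) s x t y
      else J_integral (circlepath 0 r2) (circlepath 0 r1) s x t y)"

end

theory Submission
  imports Defs "HOL-Real_Asymp.Real_Asymp"
begin

text \<open>
  Put \<open>\<lambda> = a / N\<close>. In the double integral of \<open>K\<close> shrink the \<open>u\<close>-contour to \<open>\<bar>u\<bar> = \<lambda> \<rho>1\<close>, and
  write the \<open>w\<close>-circle around \<open>1\<close> as the circle \<open>\<bar>w - 1\<bar> = 2\<close> minus a circle \<open>\<bar>w\<bar> = \<lambda> \<rho>2\<close> outside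
  the \<open>u\<close>-contour; both enclose \<open>0\<close> and \<open>u\<close>. The large circle contributes \<open>O(2 ^ (- n2))\<close> up to a
  power of \<open>N\<close>. On the small circles substitute \<open>u \<rightarrow> \<lambda> u\<close>, \<open>w \<rightarrow> \<lambda> w\<close>: since
  \<open>(1 - \<lambda> u) ^ n1\<close> tends to \<open>exp (- a t1 u)\<close>, dominated convergence gives the double integral of
  \<open>J(a t2, x2; a t1, x1)\<close> with the \<open>w\<close>-contour outside, times \<open>\<lambda> powi (x1 - x2)\<close>. The single integral
  present for \<open>n1 < n2\<close> rescales in the same way and becomes the residue at \<open>w = u\<close> that moves the
  \<open>w\<close>-contour inside. The powers of \<open>\<lambda>\<close> cancel in the determinant, and the interchange of the two
  points is a transposition.
\<close>

section \<open>Contour integrals over circles\<close>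

text \<open>Each point of \<open>pts\<close> has winding number 1 if it lies in the open disc and 0
  if it lies outside the closed one. All later deformations compare such finite sums: circles that
  enclose the same points give equal integrals, so no homotopy has to be exhibited. Essential
  singularities, such as that of \<open>exp (inverse u)\<close> at 0, are covered too.\<close>

lemma contour_integral_circlepath_eq_sum_residues:
  assumes "finite pts" "f holomorphic_on - pts" "0 < r" "pts \<inter> sphere z r = {}"
  shows "contour_integral (circlepath z r) f
           = 2 * of_real pi * \<i> * (\<Sum>p\<in>pts \<inter> ball z r. residue f p)"
proof -
  have out: "winding_number (circlepath z r) p = 0" if "p \<in> pts - ball z r" for p
  proof (rule winding_number_zero_outside[where s = "cball z r"])
    show "p \<notin> cball z r" using that assms(4) by (auto simp: less_le)
  qed (use \<open>0 < r\<close> in \<open>auto simp: valid_path_imp_path\<close>)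
  have inn: "winding_number (circlepath z r) p = 1" if "p \<in> ball z r" for p
    using that by (intro winding_number_circlepath) (auto simp: dist_norm norm_minus_commute)
  have "contour_integral (circlepath z r) f
          = 2 * pi * \<i> * (\<Sum>p\<in>pts. winding_number (circlepath z r) p * residue f p)"
    by (rule Residue_theorem[where S = UNIV])
       (use assms in \<open>auto simp: Compl_eq_Diff_UNIV\<close>)
  also have "(\<Sum>p\<in>pts. winding_number (circlepath z r) p * residue f p)
               = (\<Sum>p\<in>pts \<inter> ball z r. residue f p)"
    using \<open>finite pts\<close> by (intro sum.mono_neutral_cong_right) (auto simp: out inn)
  finally show ?thesis by simp
qed

text \<open>The parametrisation of a circle about 0 is linear in the radius, so the point and the
  derivative both acquire the factor \<open>c\<close>. Being an identity between total
  \<open>integral\<close> terms, it rewrites nested integrals directly.\<close>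

lemma contour_integral_circlepath_scale:
  fixes c :: real
  shows "contour_integral (circlepath 0 (c * r)) f
           = of_real c * contour_integral (circlepath 0 r) (\<lambda>z. f (of_real c * z))"
proof -
  have "contour_integral (circlepath 0 (c * r)) f
      = integral {0..1} (\<lambda>x. of_real c * (f (of_real c * circlepath 0 r x)
            * vector_derivative (circlepath 0 r) (at x)))"
    unfolding contour_integral_integral vector_derivative_circlepath
    by (simp add: circlepath mult_ac)
  then show ?thesis
    by (simp add: contour_integral_integral)
qed

lemma continuous_on_circlepath: "continuous_on A (circlepath z r)"
  unfolding circlepath by (intro continuous_intros)

lemma circlepath_in_sphere: "0 < r \<Longrightarrow> circlepath z r x \<in> sphere z r"
  by (simp add: circlepath dist_norm norm_mult)

lemma contour_integrable_continuous_circlepath_sphere: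
  assumes "0 < r" "continuous_on (sphere z r) f"
  shows "f contour_integrable_on circlepath z r"
  using assms by (intro contour_integrable_continuous_circlepath) simp

lemma continuous_on_contour_integral_circlepath:
  assumes "0 < r" "continuous_on (U \<times> sphere z r) (\<lambda>(u, w). f u w)"
  shows "continuous_on U (\<lambda>u. contour_integral (circlepath z r) (f u))"
proof -
  have "continuous_on (U \<times> cbox 0 1) (\<lambda>p. (fst p, circlepath z r (snd p)))"
    by (intro continuous_intros continuous_on_compose2[OF continuous_on_circlepath]) auto
  moreover have "(\<lambda>p. (fst p, circlepath z r (snd p))) ` (U \<times> cbox 0 1) \<subseteq> U \<times> sphere z r"
    using circlepath_in_sphere[OF assms(1)] by (auto simp del: mem_sphere)
  ultimately have "continuous_on (U \<times> cbox 0 1) (\<lambda>p. f (fst p) (circlepath z r (snd p)))"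
    using continuous_on_compose2[OF assms(2)] by fastforce
  then have "continuous_on (U \<times> cbox 0 1)
     (\<lambda>(u, x). f u (circlepath z r x) * vector_derivative (circlepath z r) (at x))"
    unfolding vector_derivative_circlepath case_prod_unfold o_def
    by (intro continuous_intros) auto
  from integral_continuous_on_param[OF this] show ?thesis
    by (simp add: contour_integral_integral)
qed

text \<open>Dominated convergence in the circle parameter; since the circle has finite length, a
  constant serves as dominating function.\<close>

lemma tendsto_contour_integral_circlepath:
  fixes f :: "nat \<Rightarrow> complex \<Rightarrow> complex"
  assumes "0 < r"
    and cont: "\<forall>\<^sub>F N in sequentially. continuous_on (sphere z r) (f N)"
    and bd: "\<forall>\<^sub>F N in sequentially. \<forall>u\<in>sphere z r. norm (f N u) \<le> B"
    and lim: "\<And>u. u \<in> sphere z r \<Longrightarrow> (\<lambda>N. f N u) \<longlonglongrightarrow> g u"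
  shows "(\<lambda>N. contour_integral (circlepath z r) (f N)) \<longlonglongrightarrow> contour_integral (circlepath z r) g"
proof -
  obtain N0 where N0: "\<And>N. N \<ge> N0 \<Longrightarrow> continuous_on (sphere z r) (f N)"
      "\<And>N u. N \<ge> N0 \<Longrightarrow> u \<in> sphere z r \<Longrightarrow> norm (f N u) \<le> B"
    using eventually_conj[OF cont bd] unfolding eventually_sequentially by blast
  \<comment> \<open>The hypotheses hold only from \<open>N0\<close> on, whereas
    \<open>dominated_convergence\<close> wants them for every index; the shift is undone by
    \<open>LIMSEQ_offset\<close>.\<close>
  let ?F = "\<lambda>N x. f (N + N0) (circlepath z r x) * vector_derivative (circlepath z r) (at x)"
  let ?G = "\<lambda>x. g (circlepath z r x) * vector_derivative (circlepath z r) (at x)"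
  have "(\<lambda>N. integral {0..1} (?F N)) \<longlonglongrightarrow> integral {0..1} ?G"
  proof (rule dominated_convergence(2))
    show "?F N integrable_on {0..1}" for N
      using contour_integrable_continuous_circlepath_sphere[OF \<open>0 < r\<close> N0(1)[of "N + N0"]]
      unfolding contour_integrable_on by simp
    show "(\<lambda>x. B * (2 * pi * r)) integrable_on {0..1::real}"
      by (simp add: integrable_const_ivl)
    show "norm (?F N x) \<le> B * (2 * pi * r)" if "x \<in> {0..1}" for N x
    proof -
      have "norm (?F N x) = norm (f (N + N0) (circlepath z r x)) * (2 * pi * r)"
        using \<open>0 < r\<close> by (simp add: vector_derivative_circlepath norm_mult)
      also have "\<dots> \<le> B * (2 * pi * r)"
        using N0(2)[OF _ circlepath_in_sphere[OF \<open>0 < r\<close>]] \<open>0 < r\<close>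
        by (intro mult_right_mono) auto
      finally show ?thesis .
    qed
    show "(\<lambda>N. ?F N x) \<longlonglongrightarrow> ?G x" if "x \<in> {0..1}" for x
      by (intro tendsto_mult_right LIMSEQ_ignore_initial_segment lim circlepath_in_sphere \<open>0 < r\<close>)
  qed
  then show ?thesis
    unfolding contour_integral_integral by (rule LIMSEQ_offset)
qed

text \<open>The single-circle limit is used twice: for each fixed \<open>u\<close> on the inner
  integral, then on the outer one. Joint continuity makes the inner integral continuous in
  \<open>u\<close>, and it is bounded by \<open>B\<close> times the circumference of its
  circle.\<close>

lemma tendsto_contour_integral_circlepath_double:
  fixes f :: "nat \<Rightarrow> complex \<Rightarrow> complex \<Rightarrow> complex"
  assumes "0 < r" "0 < q" "0 \<le> B"
    and cont: "\<forall>\<^sub>F N in sequentially. continuous_on (sphere z r \<times> sphere v q) (\<lambda>(u, w). f N u w)"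
    and bd: "\<forall>\<^sub>F N in sequentially. \<forall>u\<in>sphere z r. \<forall>w\<in>sphere v q. norm (f N u w) \<le> B"
    and lim: "\<And>u w. u \<in> sphere z r \<Longrightarrow> w \<in> sphere v q \<Longrightarrow> (\<lambda>N. f N u w) \<longlonglongrightarrow> g u w"
  shows "(\<lambda>N. contour_integral (circlepath z r) (\<lambda>u. contour_integral (circlepath v q) (f N u)))
           \<longlonglongrightarrow> contour_integral (circlepath z r) (\<lambda>u. contour_integral (circlepath v q) (g u))"
proof (rule tendsto_contour_integral_circlepath[OF \<open>0 < r\<close>])
  have slice: "continuous_on (sphere v q) (f N u)"
    if "continuous_on (sphere z r \<times> sphere v q) (\<lambda>(u, w). f N u w)" "u \<in> sphere z r" for N u
  proof -
    have "continuous_on (sphere v q) ((\<lambda>(u, w). f N u w) \<circ> (\<lambda>w. (u, w)))"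
      by (rule continuous_on_compose)
         (use that in \<open>auto intro!: continuous_intros intro: continuous_on_subset\<close>)
    then show ?thesis by (simp add: o_def)
  qed
  show "\<forall>\<^sub>F N in sequentially. continuous_on (sphere z r)
          (\<lambda>u. contour_integral (circlepath v q) (f N u))"
    using cont by eventually_elim (rule continuous_on_contour_integral_circlepath[OF \<open>0 < q\<close>])
  show "\<forall>\<^sub>F N in sequentially. \<forall>u\<in>sphere z r.
          norm (contour_integral (circlepath v q) (f N u)) \<le> B * (2 * pi * q)"
    using cont bd
  proof eventually_elim
    case (elim N)
    show ?case
    proof
      fix u assume u: "u \<in> sphere z r"
      have "f N u contour_integrable_on circlepath v q"
        by (intro contour_integrable_continuous_circlepath_sphere slice[OF elim(1) u] \<open>0 < q\<close>)
      from has_contour_integral_bound_circlepath[OF has_contour_integral_integral[OF this]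
          \<open>0 \<le> B\<close> \<open>0 < q\<close>]
      show "norm (contour_integral (circlepath v q) (f N u)) \<le> B * (2 * pi * q)"
        using elim(2) u by (auto simp: dist_norm norm_minus_commute)
    qed
  qed
  show "(\<lambda>N. contour_integral (circlepath v q) (f N u)) \<longlonglongrightarrow> contour_integral (circlepath v q) (g u)"
    if u: "u \<in> sphere z r" for u
  proof (rule tendsto_contour_integral_circlepath[OF \<open>0 < q\<close>, where B = B])
    show "\<forall>\<^sub>F N in sequentially. continuous_on (sphere v q) (f N u)"
      using cont by eventually_elim (rule slice[OF _ u])
    show "\<forall>\<^sub>F N in sequentially. \<forall>w\<in>sphere v q. norm (f N u w) \<le> B"
      using bd by eventually_elim (use u in blast)
  qed (use lim u in blast)
qed

lemma contour_integral_circlepath_swap: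
  assumes "0 < r" "0 < q" "continuous_on (sphere z r \<times> sphere v q) (\<lambda>(u, w). f u w)"
  shows "contour_integral (circlepath z r) (\<lambda>u. contour_integral (circlepath v q) (f u))
       = contour_integral (circlepath v q) (\<lambda>w. contour_integral (circlepath z r) (\<lambda>u. f u w))"
  by (rule contour_integral_swap)
     (use assms in \<open>auto simp: vector_derivative_circlepath intro!: continuous_intros\<close>)

text \<open>Away from 0 the integrand has the single-valued primitive
  \<open>z powi k / of_int k\<close>. This makes the single integral in \<open>K_kernel\<close>
  vanish in the limit when two limiting times agree but the positions differ.\<close>

lemma contour_integral_circlepath_power_int:
  assumes "0 < r" "k \<noteq> 0"
  shows "contour_integral (circlepath 0 r) (\<lambda>z. z powi (k - 1)) = 0"
proof -
  have "((\<lambda>z. z powi (k - 1)) has_contour_integral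
      (pathfinish (circlepath 0 r) powi k / of_int k - pathstart (circlepath 0 r) powi k / of_int k))
      (circlepath 0 r)"
    by (rule contour_integral_primitive[where S = "-{0}" and f = "\<lambda>z. z powi k / of_int k"])
       (use assms in \<open>auto intro!: derivative_eq_intros\<close>)
  then show ?thesis
    by (simp add: contour_integral_unique)
qed

section \<open>Determinants: conjugation by a diagonal matrix and passage to the limit\<close>

text \<open>In the product belonging to a permutation every \<open>c i\<close> occurs once above and
  once below the fraction bar. This removes the powers of the scale from the rescaled
  kernel.\<close>

lemma det_conjugate:
  fixes A :: "'a::field ^ 'n ^ 'n"
  assumes "\<And>i. c i \<noteq> 0"
  shows "det (\<chi> i j. c i * A $ i $ j / c j) = det A"
proof -
  have "(\<Prod>i\<in>UNIV. c i * A $ i $ p i / c (p i)) = (\<Prod>i\<in>UNIV. A $ i $ p i)"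
    if p: "p permutes UNIV" for p
  proof -
    have "(\<Prod>i\<in>UNIV. c (p i)) = prod c UNIV"
      using prod.permute[OF p, of c] by (simp add: o_def)
    then show ?thesis
      using assms by (simp add: prod_dividef prod.distrib)
  qed
  then show ?thesis
    unfolding det_def by (intro sum.cong) auto
qed

lemma tendsto_det:
  fixes A :: "'b \<Rightarrow> 'n::finite \<Rightarrow> 'n \<Rightarrow> 'a::{real_normed_field}"
  assumes "\<And>i j. ((\<lambda>N. A N i j) \<longlongrightarrow> B i j) F"
  shows "((\<lambda>N. det (\<chi> i j. A N i j)) \<longlongrightarrow> det (\<chi> i j. B i j)) F"
  unfolding det_def by (simp add: tendsto_sum tendsto_mult_left tendsto_prod assms)

section \<open>Rescaled integrands\<close>

text \<open>With \<open>z N = - lam N * u\<close> the power is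
  \<open>exp (n N * Ln (1 + z N))\<close>. The error \<open>n N * (Ln (1 + z N) - z N)\<close> is of
  order \<open>n N * norm (z N) ^ 2\<close>, a bounded quantity times one that tends to 0.\<close>

lemma tendsto_one_minus_power:
  fixes u :: complex
  assumes "lam \<longlonglongrightarrow> 0" "\<And>N. 0 < lam N" "(\<lambda>N. lam N * real (n N)) \<longlonglongrightarrow> s"
  shows "(\<lambda>N. (1 - of_real (lam N) * u) ^ n N) \<longlonglongrightarrow> exp (- (of_real s * u))"
proof -
  define z where "z N = - (of_real (lam N) * u)" for N
  have z0: "z \<longlonglongrightarrow> 0"
    unfolding z_def using tendsto_mult_left_zero[OF tendsto_of_real[OF assms(1), simplified], of u]
      tendsto_minus by fastforce
  have nz: "(\<lambda>N. of_nat (n N) * z N) \<longlonglongrightarrow> - (of_real s * u)"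
    using tendsto_minus[OF tendsto_mult_right[OF tendsto_of_real[OF assms(3)], of u]]
    unfolding z_def by (simp add: mult_ac)
  have small: "\<forall>\<^sub>F N in sequentially. norm (z N) < 1 / 2"
    using order_tendstoD(2)[OF tendsto_norm[OF z0], of "1/2"] by simp
  have "(\<lambda>N. of_nat (n N) * (Ln (1 + z N) - z N)) \<longlonglongrightarrow> 0"
  proof (rule Lim_null_comparison)
    show "\<forall>\<^sub>F N in sequentially. norm (of_nat (n N) * (Ln (1 + z N) - z N))
            \<le> 2 * norm (of_nat (n N) * z N) * norm (z N)"
      using small
    proof eventually_elim
      case (elim N)
      have "norm (Ln (1 + z N) - z N) \<le> norm (z N)^2 / (1 - norm (z N))"
        using elim by (intro Ln_approx_linear) simp
      also have "\<dots> \<le> norm (z N)^2 / (1/2)"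
        using elim by (intro divide_left_mono) auto
      finally show ?case
        using mult_left_mono[of _ _ "real (n N)"]
        by (fastforce simp: norm_mult power2_eq_square mult_ac)
    qed
    show "(\<lambda>N. 2 * norm (of_nat (n N) * z N) * norm (z N)) \<longlonglongrightarrow> 0"
      using tendsto_mult[OF tendsto_mult_left[OF tendsto_norm[OF nz], of 2] tendsto_norm[OF z0]]
      by simp
  qed
  from tendsto_exp[OF tendsto_add[OF this nz]]
  have "(\<lambda>N. exp (of_nat (n N) * Ln (1 + z N))) \<longlonglongrightarrow> exp (- (of_real s * u))"
    by (simp add: algebra_simps)
  moreover have "\<forall>\<^sub>F N in sequentially.
      exp (of_nat (n N) * Ln (1 + z N)) = (1 - of_real (lam N) * u) ^ n N"
    using small
  proof eventually_elim
    case (elim N)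
    have "1 + z N \<noteq> 0"
    proof
      assume "1 + z N = 0"
      then have "z N = - 1" by (simp add: add_eq_0_iff)
      then show False using elim by simp
    qed
    then show ?case
      by (simp add: exp_of_nat_mult z_def)
  qed
  ultimately show ?thesis
    by (blast intro: Lim_transform_eventually)
qed

lemma norm_one_minus_power_le:
  assumes "0 \<le> c"
  shows "norm ((1 - of_real c * u :: complex) ^ n) \<le> exp (c * real n * norm u)"
proof -
  have "norm (1 - of_real c * u) \<le> 1 + c * norm u"
    using norm_triangle_ineq4[of 1 "of_real c * u"] assms by (simp add: norm_mult)
  also have "\<dots> \<le> exp (c * norm u)"
    by (rule exp_ge_add_one_self)
  finally have "norm (1 - of_real c * u) ^ n \<le> exp (c * norm u) ^ n"
    by (intro power_mono) auto
  then show ?thesis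
    by (simp add: norm_power exp_of_nat_mult[symmetric] mult_ac)
qed

text \<open>For \<open>0 \<le> y \<le> 1/2\<close> one has
  \<open>(1 + 2 * y) * (1 - y) = 1 + y * (1 - 2 * y) \<ge> 1\<close>, hence
  \<open>1 / (1 - y) \<le> exp (2 * y)\<close>.\<close>

lemma norm_inverse_one_minus_power_le:
  assumes "0 \<le> c" "c * norm u \<le> 1 / 2"
  shows "norm (inverse ((1 - of_real c * u :: complex) ^ n)) \<le> exp (2 * (c * real n * norm u))"
proof -
  define y where "y = c * norm u"
  have y: "0 \<le> y" "y \<le> 1/2" using assms by (auto simp: y_def)
  have "1 - y \<le> norm (1 - of_real c * u)"
    using norm_triangle_ineq2[of 1 "of_real c * u"] assms by (simp add: norm_mult y_def)
  moreover have "1 \<le> exp (2 * y) * (1 - y)"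
  proof -
    have "0 \<le> y * (1 - 2 * y)" using y by (intro mult_nonneg_nonneg) auto
    then have "1 \<le> (1 + 2 * y) * (1 - y)" by (simp add: algebra_simps)
    also have "\<dots> \<le> exp (2 * y) * (1 - y)"
      using y exp_ge_add_one_self[of "2 * y"] by (intro mult_right_mono) auto
    finally show ?thesis .
  qed
  ultimately have "1 \<le> exp (2 * y) * norm (1 - of_real c * u)" "0 < norm (1 - of_real c * u)"
    using y by (auto intro: order_trans mult_left_mono)
  then have "inverse (norm (1 - of_real c * u)) \<le> exp (2 * y)"
    by (simp add: field_simps)
  then have "inverse (norm (1 - of_real c * u)) ^ n \<le> exp (2 * y) ^ n"
    by (intro power_mono) auto
  then show ?thesis
    by (simp add: norm_power norm_inverse power_inverse exp_of_nat_mult[symmetric] y_def mult_ac)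
qed

text \<open>One function serves both variables: the double integrand of \<open>K_kernel\<close> is
  its value at \<open>u\<close> with exponent \<open>x1\<close>, divided by its value at
  \<open>w\<close> with exponent \<open>x2 + 1\<close> and by \<open>u - w\<close>.\<close>

definition plancherel_factor :: "real \<Rightarrow> real \<Rightarrow> nat \<Rightarrow> int \<Rightarrow> complex \<Rightarrow> complex" where
  "plancherel_factor a b n x u =
     exp (of_real a * u + of_real b * inverse u) * u powi x * (1 - u) ^ n"

definition limit_factor :: "real \<Rightarrow> int \<Rightarrow> complex \<Rightarrow> complex" where
  "limit_factor s x u = exp (inverse u - of_real s * u) * u powi x"

text \<open>\<open>lam\<close> stands for \<open>a / N\<close>, the same order as \<open>gp\<close>.
  Near 0 the two parameters act differently: after \<open>u\<close> is replaced by
  \<open>lam * u\<close>, the term with \<open>gp\<close> becomes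
  \<open>gp / lam * inverse u\<close> and survives, while the one with \<open>gm\<close> becomes
  \<open>gm * lam * u\<close> and disappears.\<close>

locale plancherel_scaling =
  fixes gm gp lam :: "nat \<Rightarrow> real"
  assumes gm_nonneg: "0 \<le> gm N" and gp_nonneg: "0 \<le> gp N" and lam_pos: "0 < lam N"
    and lam_lim: "lam \<longlonglongrightarrow> 0" and gm_lim: "gm \<longlonglongrightarrow> 0"
    and gp_lim: "(\<lambda>N. gp N / lam N) \<longlonglongrightarrow> 1"
begin

text \<open>Dividing out the power of \<open>lam\<close> produced by the monomial leaves a quantity
  with a finite limit, namely \<open>limit_factor\<close>.\<close>

definition scaled_factor :: "nat \<Rightarrow> nat \<Rightarrow> int \<Rightarrow> complex \<Rightarrow> complex" where
  "scaled_factor N n x u =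
     plancherel_factor (gm N) (gp N) n x (of_real (lam N) * u) / of_real (lam N) powi x"

lemma scaled_factor_eq:
  "scaled_factor N n x u =
     exp (of_real (gm N * lam N) * u + of_real (gp N / lam N) * inverse u)
       * u powi x * (1 - of_real (lam N) * u) ^ n"
  using lam_pos[of N]
  by (simp add: scaled_factor_def plancherel_factor_def power_int_mult_distrib field_simps)

lemma gm_lam_lim: "(\<lambda>N. gm N * lam N) \<longlonglongrightarrow> 0"
  using tendsto_mult[OF gm_lim lam_lim] by simp

lemma scaled_factor_tendsto:
  assumes "(\<lambda>N. lam N * real (n N)) \<longlonglongrightarrow> s"
  shows "(\<lambda>N. scaled_factor N (n N) x u) \<longlonglongrightarrow> limit_factor s x u"
proof -
  have "(\<lambda>N. scaled_factor N (n N) x u) \<longlonglongrightarrow>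
     exp (of_real 0 * u + of_real 1 * inverse u) * u powi x * exp (- (of_real s * u))"
    unfolding scaled_factor_eq
    by (intro tendsto_mult tendsto_exp tendsto_add tendsto_of_real gm_lam_lim gp_lim tendsto_const
        tendsto_one_minus_power lam_lim lam_pos assms)
  then show ?thesis
    by (simp add: limit_factor_def exp_diff exp_minus field_simps)
qed

text \<open>Both the factor and its inverse are bounded, because the factor stands in the numerator
  for \<open>u\<close> and in the denominator for \<open>w\<close>.\<close>

lemma scaled_factor_bound:
  assumes "0 < \<rho>" "(\<lambda>N. lam N * real (n N)) \<longlonglongrightarrow> s"
  obtains C where "0 \<le> C"
    "\<forall>\<^sub>F N in sequentially. \<forall>u\<in>sphere 0 \<rho>.
        norm (scaled_factor N (n N) x u) \<le> C \<and> norm (inverse (scaled_factor N (n N) x u)) \<le> C"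
proof -
  \<comment> \<open>\<open>b N\<close> dominates the factor and its inverse at once: the sum of the
    two powers of \<open>\<rho>\<close> covers \<open>u powi x\<close> and its inverse, and the 2 in
    the last exponent comes from the inverse of \<open>(1 - lam N * u) ^ n N\<close>. As
    \<open>b\<close> converges, it is eventually below its limit plus 1.\<close>
  define b where "b N = exp (gm N * lam N * \<rho> + gp N / lam N * inverse \<rho>)
    * (\<rho> powi x + \<rho> powi (-x)) * exp (2 * (lam N * real (n N) * \<rho>))" for N
  define C where "C = exp (0 * \<rho> + 1 * inverse \<rho>)
    * (\<rho> powi x + \<rho> powi (-x)) * exp (2 * (s * \<rho>)) + 1"
  have "b \<longlonglongrightarrow> C - 1"
    unfolding b_def C_def add_diff_cancel_right'
    by (intro tendsto_mult tendsto_exp tendsto_add tendsto_const gm_lam_lim gp_lim assms(2))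
  then have evb: "\<forall>\<^sub>F N in sequentially. b N < C"
    by (rule order_tendstoD) simp
  have "\<forall>\<^sub>F N in sequentially. lam N * \<rho> < 1/2"
    using order_tendstoD(2)[OF tendsto_mult_left_zero[OF lam_lim, of \<rho>], of "1/2"] by simp
  with evb have ev: "\<forall>\<^sub>F N in sequentially. \<forall>u\<in>sphere 0 \<rho>.
        norm (scaled_factor N (n N) x u) \<le> C \<and> norm (inverse (scaled_factor N (n N) x u)) \<le> C"
  proof eventually_elim
    case (elim N)
    show ?case
    proof
      fix u :: complex assume "u \<in> sphere 0 \<rho>"
      then have u: "norm u = \<rho>" by simp
      let ?e = "of_real (gm N * lam N) * u + of_real (gp N / lam N) * inverse u"
      have ne: "norm ?e \<le> gm N * lam N * \<rho> + gp N / lam N * inverse \<rho>"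
        using gm_nonneg[of N] gp_nonneg[of N] lam_pos[of N]
        by (intro norm_triangle_le add_mono) (auto simp: norm_mult norm_inverse norm_divide u)
      have e1: "norm (exp ?e) \<le> exp (gm N * lam N * \<rho> + gp N / lam N * inverse \<rho>)"
        using norm_exp[of ?e] ne by (meson exp_le_cancel_iff order_trans)
      have e2: "norm (inverse (exp ?e)) \<le> exp (gm N * lam N * \<rho> + gp N / lam N * inverse \<rho>)"
        using norm_exp[of "- ?e"] ne unfolding exp_minus[symmetric] norm_minus_cancel
        by (meson exp_le_cancel_iff order_trans)
      have p1: "norm (u powi x) \<le> \<rho> powi x + \<rho> powi (-x)"
        using \<open>0 < \<rho>\<close> by (simp add: norm_power_int u zero_le_power_int)
      have p2: "norm (inverse (u powi x)) \<le> \<rho> powi x + \<rho> powi (-x)"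
        using \<open>0 < \<rho>\<close> by (simp add: norm_inverse norm_power_int u power_int_minus zero_le_power_int)
      have "norm ((1 - of_real (lam N) * u) ^ n N) \<le> exp (lam N * real (n N) * norm u)"
        using lam_pos[of N] by (intro norm_one_minus_power_le) simp
      also have "\<dots> \<le> exp (2 * (lam N * real (n N) * \<rho>))"
        using lam_pos[of N] \<open>0 < \<rho>\<close> by (simp add: u)
      finally have q1: "norm ((1 - of_real (lam N) * u) ^ n N) \<le> exp (2 * (lam N * real (n N) * \<rho>))" .
      have q2: "norm (inverse ((1 - of_real (lam N) * u) ^ n N)) \<le> exp (2 * (lam N * real (n N) * \<rho>))"
        using norm_inverse_one_minus_power_le[of "lam N" u "n N"] lam_pos[of N] elim(2)
        by (simp add: u)
      have "norm (scaled_factor N (n N) x u) \<le> b N"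
        unfolding scaled_factor_eq norm_mult b_def using e1 p1 q1
        by (intro mult_mono) (auto simp: \<open>0 < \<rho>\<close> zero_le_power_int less_imp_le)
      moreover have "norm (inverse (scaled_factor N (n N) x u)) \<le> b N"
        unfolding scaled_factor_eq inverse_mult_distrib norm_mult b_def using e2 p2 q2
        by (intro mult_mono) (auto simp: \<open>0 < \<rho>\<close> zero_le_power_int less_imp_le)
      ultimately show "norm (scaled_factor N (n N) x u) \<le> C \<and>
          norm (inverse (scaled_factor N (n N) x u)) \<le> C"
        using elim(1) by simp
    qed
  qed
  have "0 \<le> C" unfolding C_def using \<open>0 < \<rho>\<close> by (simp add: zero_le_power_int)
  from that[OF this ev] show thesis .
qed

end

section \<open>Deformation of the contours\<close>

lemma contour_integral_cmult:
  "contour_integral g (\<lambda>z. c * f z) = c * contour_integral g f"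
  by (simp add: contour_integral_integral mult.assoc)

lemma continuous_on_Cauchy_kernel:
  fixes A B :: "complex \<Rightarrow> complex"
  assumes "continuous_on U A" "continuous_on W B" "U \<inter> W = {}"
  shows "continuous_on (U \<times> W) (\<lambda>(u, w). A u * B w / (w - u))"
  unfolding case_prod_unfold
  by (intro continuous_intros continuous_on_compose2[OF assms(1)] continuous_on_compose2[OF assms(2)])
     (use assms(3) in auto)

lemma spheres_at_0_disjoint: "a \<noteq> b \<Longrightarrow> sphere 0 a \<inter> sphere (0::'a::real_normed_vector) b = {}"
  by auto

text \<open>For fixed \<open>w\<close> near 1 the only singularity in \<open>u\<close> inside radius
  \<open>r\<close> is 0, so the \<open>u\<close>-circle may shrink. After exchanging the integrals,
  the singularities in \<open>w\<close> are 0, \<open>u\<close> and 1: the circle of radius 2 about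
  1 encloses all three, the one of radius \<open>\<rho>2\<close> about 0 only the first two, and the
  difference isolates 1.\<close>

lemma contour_integral_Cauchy_kernel_deform:
  assumes A: "A holomorphic_on - {0}" and B: "B holomorphic_on - {0, 1}"
    and "0 < \<rho>1" "\<rho>1 < \<rho>2" "\<rho>2 < 1" "\<rho>1 < r" "r < 1" "0 < e" "e < 1 - r"
  shows "contour_integral (circlepath 1 e) (\<lambda>w. contour_integral (circlepath 0 r)
            (\<lambda>u. A u * B w / (w - u)))
       = contour_integral (circlepath 0 \<rho>1) (\<lambda>u. contour_integral (circlepath 1 2)
            (\<lambda>w. A u * B w / (w - u)))
       - contour_integral (circlepath 0 \<rho>1) (\<lambda>u. contour_integral (circlepath 0 \<rho>2)
            (\<lambda>w. A u * B w / (w - u)))"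
proof -
  let ?G = "\<lambda>u w. A u * B w / (w - u)"
  have cA: "continuous_on (sphere 0 \<rho>1) A"
    using assms by (intro holomorphic_on_imp_continuous_on holomorphic_on_subset[OF A]) auto
  have cB: "continuous_on S B" if "0 \<notin> S" "1 \<notin> S" for S
    using that by (intro holomorphic_on_imp_continuous_on holomorphic_on_subset[OF B]) auto
  \<comment> \<open>\<open>e < 1 - r\<close> keeps the disc about 1 clear of the disc of radius
    \<open>r\<close> about 0.\<close>
  have far1: "r < norm w" if "w \<in> cball 1 e" for w :: complex
    using that norm_triangle_ineq2[of 1 "1 - w"] assms by (simp add: dist_norm)
  have far2: "e < dist 1 u" "u \<noteq> 0" "u \<noteq> 1" "dist 1 u < 2" if "u \<in> sphere 0 \<rho>1" for u :: complex
    using that norm_triangle_ineq2[of 1 u] norm_triangle_ineq4[of 1 u] assms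
    by (auto simp: dist_norm)
  have inner: "contour_integral (circlepath 0 r) (\<lambda>u. ?G u w)
             = contour_integral (circlepath 0 \<rho>1) (\<lambda>u. ?G u w)" if "w \<in> sphere 1 e" for w
  proof -
    have "(\<lambda>u. ?G u w) holomorphic_on - {0, w}"
      by (intro holomorphic_intros holomorphic_on_subset[OF A]) auto
    then have *: "contour_integral (circlepath 0 q) (\<lambda>u. ?G u w)
        = 2 * of_real pi * \<i> * (\<Sum>p\<in>{0, w} \<inter> ball 0 q. residue (\<lambda>u. ?G u w) p)"
      if "0 < q" "q \<le> r" for q
      using that far1[of w] \<open>w \<in> sphere 1 e\<close>
      by (intro contour_integral_circlepath_eq_sum_residues) auto
    have X: "{0, w} \<inter> ball 0 q = {0}" if "0 < q" "q \<le> r" for q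
      using that far1[of w] \<open>w \<in> sphere 1 e\<close> by auto
    have "contour_integral (circlepath 0 q) (\<lambda>u. ?G u w)
        = 2 * of_real pi * \<i> * residue (\<lambda>u. ?G u w) 0" if "0 < q" "q \<le> r" for q
      unfolding *[OF that] X[OF that] by simp
    from this[of r] this[of \<rho>1] show ?thesis using assms by simp
  qed
  have outer: "contour_integral (circlepath 1 e) (?G u)
      = contour_integral (circlepath 1 2) (?G u) - contour_integral (circlepath 0 \<rho>2) (?G u)"
    if u: "u \<in> sphere 0 \<rho>1" for u
  proof -
    have hol: "?G u holomorphic_on - {0, u, 1}"
      by (intro holomorphic_intros holomorphic_on_subset[OF B]) auto
    have *: "contour_integral (circlepath z q) (?G u)
        = 2 * of_real pi * \<i> * (\<Sum>p\<in>{0, u, 1} \<inter> ball z q. residue (?G u) p)"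
      if "0 < q" "{0, u, 1} \<inter> sphere z q = {}" for z q
      using that hol by (intro contour_integral_circlepath_eq_sum_residues) auto
    have X: "{0, u, 1} \<inter> ball 1 e = {1}" "{0, u, 1} \<inter> ball 1 2 = {0, u, 1}"
      "{0, u, 1} \<inter> ball 0 \<rho>2 = {0, u}"
      using far2[OF u] u assms by auto
    have Y: "{0, u, 1} \<inter> sphere 1 e = {}" "{0, u, 1} \<inter> sphere 1 2 = {}"
      "{0, u, 1} \<inter> sphere 0 \<rho>2 = {}"
      using far2[OF u] u assms by auto
    have "(0::real) < 2" "0 < \<rho>2" using assms by auto
    show ?thesis
      unfolding *[OF \<open>0 < e\<close> Y(1)] *[OF \<open>0 < 2\<close> Y(2)] *[OF \<open>0 < \<rho>2\<close> Y(3)] X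
      using far2[OF u] by (simp add: distrib_left)
  qed
  have cG1: "continuous_on (sphere 0 \<rho>1 \<times> sphere 1 e) (\<lambda>(u, w). ?G u w)"
    by (intro continuous_on_Cauchy_kernel cA cB) (use assms far2(1) in \<open>fastforce+\<close>)
  have cG2: "continuous_on (sphere 0 \<rho>1 \<times> sphere 1 2) (\<lambda>(u, w). ?G u w)"
    by (intro continuous_on_Cauchy_kernel cA cB) (use assms far2(4) in \<open>fastforce+\<close>)
  have cG3: "continuous_on (sphere 0 \<rho>1 \<times> sphere 0 \<rho>2) (\<lambda>(u, w). ?G u w)"
    by (intro continuous_on_Cauchy_kernel cA cB spheres_at_0_disjoint) (use assms in auto)
  have "contour_integral (circlepath 1 e) (\<lambda>w. contour_integral (circlepath 0 r) (\<lambda>u. ?G u w))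
      = contour_integral (circlepath 1 e) (\<lambda>w. contour_integral (circlepath 0 \<rho>1) (\<lambda>u. ?G u w))"
    using \<open>0 < e\<close> by (intro contour_integral_eq inner) simp
  also have "\<dots> = contour_integral (circlepath 0 \<rho>1) (\<lambda>u. contour_integral (circlepath 1 e) (?G u))"
    using assms cG1 by (intro contour_integral_circlepath_swap[symmetric])
  also have "\<dots> = contour_integral (circlepath 0 \<rho>1) (\<lambda>u.
      contour_integral (circlepath 1 2) (?G u) - contour_integral (circlepath 0 \<rho>2) (?G u))"
    using \<open>0 < \<rho>1\<close> by (intro contour_integral_eq outer) simp
  also have "\<dots> = contour_integral (circlepath 0 \<rho>1) (\<lambda>u. contour_integral (circlepath 1 2) (?G u))
      - contour_integral (circlepath 0 \<rho>1) (\<lambda>u. contour_integral (circlepath 0 \<rho>2) (?G u))"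
    using assms cG2 cG3
    by (intro contour_integral_diff contour_integrable_continuous_circlepath_sphere
        continuous_on_contour_integral_circlepath) auto
  finally show ?thesis .
qed

lemma holomorphic_plancherel_factor: "plancherel_factor a b n x holomorphic_on - {0}"
  unfolding plancherel_factor_def[abs_def] by (intro holomorphic_intros) auto

lemma plancherel_factor_nonzero: "u \<noteq> 0 \<Longrightarrow> u \<noteq> 1 \<Longrightarrow> plancherel_factor a b n x u \<noteq> 0"
  by (simp add: plancherel_factor_def)

lemma holomorphic_inverse_plancherel_factor:
  "(\<lambda>w. inverse (plancherel_factor a b n x w)) holomorphic_on - {0, 1}"
  by (intro holomorphic_intros holomorphic_on_subset[OF holomorphic_plancherel_factor])
     (auto simp: plancherel_factor_nonzero)

lemma holomorphic_limit_factor: "limit_factor s x holomorphic_on - {0}"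
  unfolding limit_factor_def[abs_def] by (intro holomorphic_intros) auto

lemma limit_factor_nonzero: "u \<noteq> 0 \<Longrightarrow> limit_factor s x u \<noteq> 0"
  by (simp add: limit_factor_def)

lemma holomorphic_inverse_limit_factor:
  "(\<lambda>w. inverse (limit_factor s x w)) holomorphic_on - {0}"
  by (intro holomorphic_intros holomorphic_limit_factor) (auto simp: limit_factor_nonzero)

section \<open>The limiting double integral and the order of its contours\<close>

text \<open>The double integral of \<open>J_integral\<close> with \<open>w\<close> innermost, so
  that the \<open>w\<close>-circle can be moved for each fixed \<open>u\<close>. Either radius may
  be the larger one, which covers both contour orders of \<open>J_kernel\<close>.\<close>

definition limit_double :: "real \<Rightarrow> real \<Rightarrow> real \<Rightarrow> int \<Rightarrow> real \<Rightarrow> int \<Rightarrow> complex" where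
  "limit_double \<rho>1 \<rho>2 s x t y =
     contour_integral (circlepath 0 \<rho>1) (\<lambda>u. contour_integral (circlepath 0 \<rho>2)
       (\<lambda>w. limit_factor t y u * inverse (limit_factor s (x + 1) w) / (w - u)))"

lemma J_integral_eq_limit_double:
  assumes "0 < \<rho>1" "0 < \<rho>2" "\<rho>1 \<noteq> \<rho>2"
  shows "J_integral (circlepath 0 \<rho>1) (circlepath 0 \<rho>2) s x t y
           = (1 / (2 * of_real pi * \<i>)) ^ 2 * limit_double \<rho>1 \<rho>2 s x t y"
proof -
  have eq: "exp (inverse u - of_real t * u - inverse w + of_real s * w) / (w - u) *
         (1 / (w powi (x + 1) * u powi (- y)))
       = limit_factor t y u * inverse (limit_factor s (x + 1) w) / (w - u)" for u w
  proof -
    have "inverse u - of_real t * u - inverse w + of_real s * w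
        = (inverse u - of_real t * u) + - (inverse w - of_real s * w)" by simp
    then have "exp (inverse u - of_real t * u - inverse w + of_real s * w)
       = exp (inverse u - of_real t * u) * inverse (exp (inverse w - of_real s * w))"
      by (simp only: exp_add exp_minus)
    then show ?thesis
      by (simp add: limit_factor_def power_int_minus divide_inverse mult_ac)
  qed
  have "continuous_on (sphere 0 \<rho>1 \<times> sphere 0 \<rho>2)
      (\<lambda>(u, w). limit_factor t y u * inverse (limit_factor s (x + 1) w) / (w - u))"
    using assms
    by (intro continuous_on_Cauchy_kernel spheres_at_0_disjoint holomorphic_on_imp_continuous_on
        holomorphic_on_subset[OF holomorphic_limit_factor]
        holomorphic_on_subset[OF holomorphic_inverse_limit_factor]) auto
  from contour_integral_circlepath_swap[OF assms(1,2) this]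
  show ?thesis
    unfolding J_integral_def limit_double_def eq by simp
qed

text \<open>Moving the \<open>w\<close>-contour across the \<open>u\<close>-contour picks up the residue at \<open>w = u\<close>.\<close>
lemma limit_double_cross:
  assumes "0 < q1" "q1 < \<rho>" "\<rho> < q2"
  shows "limit_double \<rho> q1 s x t y
       = limit_double \<rho> q2 s x t y
         - 2 * of_real pi * \<i> * contour_integral (circlepath 0 \<rho>)
             (\<lambda>u. exp (of_real (s - t) * u) * u powi (y - x - 1))"
proof -
  let ?B = "\<lambda>w. inverse (limit_factor s (x + 1) w)"
  let ?G = "\<lambda>u w. limit_factor t y u * ?B w / (w - u)"
  let ?R = "\<lambda>u. 2 * of_real pi * \<i> * (exp (of_real (s - t) * u) * u powi (y - x - 1))"
  have "0 < \<rho>" "0 < q2" using assms by auto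
  have cross: "contour_integral (circlepath 0 q1) (?G u) = contour_integral (circlepath 0 q2) (?G u) - ?R u"
    if u: "u \<in> sphere 0 \<rho>" for u
  proof -
    have "u \<noteq> 0" using u \<open>0 < \<rho>\<close> by auto
    have hol: "(\<lambda>w. limit_factor t y u * ?B w) holomorphic_on - {0}"
      by (intro holomorphic_intros holomorphic_inverse_limit_factor)
    have "?G u holomorphic_on - {0, u}"
      by (intro holomorphic_intros holomorphic_on_subset[OF holomorphic_inverse_limit_factor]) auto
    then have *: "contour_integral (circlepath 0 q) (?G u)
        = 2 * of_real pi * \<i> * (\<Sum>p\<in>{0, u} \<inter> ball 0 q. residue (?G u) p)"
      if "0 < q" "q \<noteq> \<rho>" for q
      using that u by (intro contour_integral_circlepath_eq_sum_residues) auto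
    have "residue (?G u) u = limit_factor t y u * ?B u"
      using residue_simple[OF _ _ hol, of u] \<open>u \<noteq> 0\<close> by auto
    \<comment> \<open>At \<open>w = u\<close> the essentially singular factors
      \<open>exp (inverse u)\<close> cancel, leaving exactly the limit integrand of the single
      integral in \<open>K_kernel\<close>.\<close>
    also have "\<dots> = exp (of_real (s - t) * u) * u powi (y - x - 1)"
    proof -
      have 1: "exp (inverse u - of_real t * u) * inverse (exp (inverse u - of_real s * u))
          = exp (of_real (s - t) * u)"
        by (simp add: exp_minus[symmetric] exp_add[symmetric] algebra_simps)
      have 2: "u powi y * inverse (u powi (x + 1)) = u powi (y - x - 1)"
        using \<open>u \<noteq> 0\<close> by (simp add: power_int_minus[symmetric] power_int_add[symmetric] algebra_simps)
      have "limit_factor t y u * ?B u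
          = (exp (inverse u - of_real t * u) * inverse (exp (inverse u - of_real s * u)))
            * (u powi y * inverse (u powi (x + 1)))"
        by (simp only: limit_factor_def inverse_mult_distrib mult_ac)
      then show ?thesis by (simp only: 1 2)
    qed
    finally have res: "residue (?G u) u = exp (of_real (s - t) * u) * u powi (y - x - 1)" .
    have X: "{0, u} \<inter> ball 0 q1 = {0}" "{0, u} \<inter> ball 0 q2 = {0, u}"
      using u assms by auto
    have "q1 \<noteq> \<rho>" "q2 \<noteq> \<rho>" using assms by auto
    show ?thesis
      unfolding *[OF \<open>0 < q1\<close> \<open>q1 \<noteq> \<rho>\<close>] *[OF \<open>0 < q2\<close> \<open>q2 \<noteq> \<rho>\<close>] X
      using res \<open>u \<noteq> 0\<close> by (simp add: distrib_left)
  qed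
  have "limit_double \<rho> q1 s x t y
      = contour_integral (circlepath 0 \<rho>) (\<lambda>u. contour_integral (circlepath 0 q2) (?G u) - ?R u)"
    unfolding limit_double_def using \<open>0 < \<rho>\<close> by (intro contour_integral_eq cross) simp
  also have "\<dots> = limit_double \<rho> q2 s x t y - contour_integral (circlepath 0 \<rho>) ?R"
    unfolding limit_double_def
  proof (intro contour_integral_diff contour_integrable_continuous_circlepath_sphere \<open>0 < \<rho>\<close>
      continuous_on_contour_integral_circlepath \<open>0 < q2\<close>)
    show "continuous_on (sphere 0 \<rho> \<times> sphere 0 q2) (\<lambda>(u, w). ?G u w)"
      using assms
      by (intro continuous_on_Cauchy_kernel spheres_at_0_disjoint holomorphic_on_imp_continuous_on
        holomorphic_on_subset[OF holomorphic_limit_factor]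
        holomorphic_on_subset[OF holomorphic_inverse_limit_factor]) auto
    show "continuous_on (sphere 0 \<rho>) ?R"
      using \<open>0 < \<rho>\<close> by (intro continuous_intros) auto
  qed
  finally show ?thesis by (simp add: contour_integral_cmult)
qed

section \<open>Limits of the rescaled integrals\<close>

lemma tendsto_real_power_int_div_exp:
  "(\<lambda>m. real m powi k / 2 ^ m) \<longlonglongrightarrow> 0"
proof (rule Lim_null_comparison)
  show "(\<lambda>m. real m powr real_of_int \<bar>k\<bar> * (1/2) ^ m) \<longlonglongrightarrow> 0"
    by real_asymp
  show "\<forall>\<^sub>F m in sequentially. norm (real m powi k / 2 ^ m) \<le> real m powr real_of_int \<bar>k\<bar> * (1/2) ^ m"
    using eventually_ge_at_top[of 1]
  proof eventually_elim
    case (elim m)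
    have "real m powi k = real m powr real_of_int k"
      using elim by (simp add: powr_real_of_int')
    also have "\<dots> \<le> real m powr real_of_int \<bar>k\<bar>"
      using elim by (intro powr_mono) auto
    finally show ?case
      by (simp add: power_one_over field_simps zero_le_power_int)
  qed
qed

context plancherel_scaling
begin

lemma lam_mult_less: "0 < c \<Longrightarrow> \<forall>\<^sub>F N in sequentially. lam N * \<rho> < c"
  using order_tendstoD(2)[OF tendsto_mult_left_zero[OF lam_lim, of \<rho>]] by simp

lemma plancherel_factor_scale:
  "plancherel_factor (gm N) (gp N) n x (of_real (lam N) * u)
     = of_real (lam N) powi x * scaled_factor N n x u"
  using lam_pos[of N] by (simp add: scaled_factor_def)

lemma continuous_on_scaled_factor:
  assumes "0 < \<rho>"
  shows "continuous_on (sphere 0 \<rho>) (scaled_factor N n x)"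
  unfolding scaled_factor_eq[abs_def]
  by (intro continuous_intros) (use assms in auto)

lemma continuous_on_inverse_scaled_factor:
  assumes "0 < \<rho>" "lam N * \<rho> < 1"
  shows "continuous_on (sphere 0 \<rho>) (\<lambda>w. inverse (scaled_factor N n x w))"
proof (intro continuous_on_inverse continuous_on_scaled_factor ballI \<open>0 < \<rho>\<close>)
  fix w :: complex assume w: "w \<in> sphere 0 \<rho>"
  have "of_real (lam N) * w \<noteq> 1"
  proof
    assume "of_real (lam N) * w = 1"
    then have "norm (of_real (lam N) * w) = 1" by simp
    with w assms lam_pos[of N] show False by (simp add: norm_mult)
  qed
  with w assms show "scaled_factor N n x w \<noteq> 0"
    by (auto simp: scaled_factor_eq)
qed

text \<open>The two differentials give \<open>lam ^ 2\<close>, the Cauchy kernel gives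
  \<open>inverse lam\<close>, and the two factors give \<open>lam powi (x1 - x2 - 1)\<close>. The
  total, \<open>lam powi (x1 - x2)\<close>, is cancelled by the prefactor.\<close>

lemma scaled_double:
  "of_real (lam N) powi (x2 - x1) *
     contour_integral (circlepath 0 (lam N * \<rho>1)) (\<lambda>u. contour_integral (circlepath 0 (lam N * \<rho>2))
       (\<lambda>w. plancherel_factor (gm N) (gp N) n1 x1 u
             * inverse (plancherel_factor (gm N) (gp N) n2 (x2 + 1) w) / (w - u)))
   = contour_integral (circlepath 0 \<rho>1) (\<lambda>u. contour_integral (circlepath 0 \<rho>2)
       (\<lambda>w. scaled_factor N n1 x1 u * inverse (scaled_factor N n2 (x2 + 1) w) / (w - u)))"
proof -
  define l where "l = complex_of_real (lam N)"
  have "l \<noteq> 0" using lam_pos[of N] by (simp add: l_def)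
  have eq: "plancherel_factor (gm N) (gp N) n1 x1 (l * u)
             * inverse (plancherel_factor (gm N) (gp N) n2 (x2 + 1) (l * w)) / (l * w - l * u)
      = l powi (x1 - x2 - 2) *
        (scaled_factor N n1 x1 u * inverse (scaled_factor N n2 (x2 + 1) w) / (w - u))" for u w
  proof -
    have "l powi (x1 - x2 - 2) = l powi x1 * inverse (l powi (x2 + 1)) * inverse l"
      using \<open>l \<noteq> 0\<close> power_int_diff[of l x1 "x2 + 1"] power_int_diff[of l "x1 - (x2 + 1)" 1]
      by (simp add: divide_inverse)
    then show ?thesis
      unfolding l_def plancherel_factor_scale right_diff_distrib[symmetric]
      by (simp add: divide_inverse mult_ac)
  qed
  have "l powi (x2 - x1) * (l * (l * l powi (x1 - x2 - 2))) = 1"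
    using \<open>l \<noteq> 0\<close> power_int_add[of l "x2 - x1" "x1 - x2 - 2"] power_int_add[of l "-2" 2]
    by (simp add: power2_eq_square mult_ac)
  then show ?thesis
    unfolding contour_integral_circlepath_scale l_def[symmetric] eq contour_integral_cmult
    by (simp add: mult.assoc[symmetric])
qed

lemma scaled_double_tendsto:
  assumes "0 < \<rho>1" "0 < \<rho>2" "\<rho>1 \<noteq> \<rho>2"
    and "(\<lambda>N. lam N * real (n1 N)) \<longlonglongrightarrow> s1" "(\<lambda>N. lam N * real (n2 N)) \<longlonglongrightarrow> s2"
  shows "(\<lambda>N. contour_integral (circlepath 0 \<rho>1) (\<lambda>u. contour_integral (circlepath 0 \<rho>2)
       (\<lambda>w. scaled_factor N (n1 N) x1 u * inverse (scaled_factor N (n2 N) (x2 + 1) w) / (w - u))))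
     \<longlonglongrightarrow> limit_double \<rho>1 \<rho>2 s2 x2 s1 x1"
proof -
  obtain C1 where C1: "0 \<le> C1" "\<forall>\<^sub>F N in sequentially. \<forall>u\<in>sphere 0 \<rho>1.
        norm (scaled_factor N (n1 N) x1 u) \<le> C1 \<and> norm (inverse (scaled_factor N (n1 N) x1 u)) \<le> C1"
    using scaled_factor_bound[OF assms(1,4)] .
  obtain C2 where C2: "0 \<le> C2" "\<forall>\<^sub>F N in sequentially. \<forall>w\<in>sphere 0 \<rho>2.
        norm (scaled_factor N (n2 N) (x2 + 1) w) \<le> C2
        \<and> norm (inverse (scaled_factor N (n2 N) (x2 + 1) w)) \<le> C2"
    using scaled_factor_bound[OF assms(2,5)] .
  show ?thesis
    unfolding limit_double_def
  \<comment> \<open>The denominator of \<open>B\<close> is the distance between the two concentric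
    circles, a lower bound for \<open>norm (w - u)\<close>.\<close>
  proof (rule tendsto_contour_integral_circlepath_double[OF assms(1,2), where B = "C1 * C2 / \<bar>\<rho>2 - \<rho>1\<bar>"])
    show "0 \<le> C1 * C2 / \<bar>\<rho>2 - \<rho>1\<bar>" using C1 C2 by simp
    show "\<forall>\<^sub>F N in sequentially. continuous_on (sphere 0 \<rho>1 \<times> sphere 0 \<rho>2)
       (\<lambda>(u, w). scaled_factor N (n1 N) x1 u * inverse (scaled_factor N (n2 N) (x2 + 1) w) / (w - u))"
      using lam_mult_less[of 1 \<rho>2, simplified]
      by eventually_elim
         (intro continuous_on_Cauchy_kernel spheres_at_0_disjoint continuous_on_scaled_factor
            continuous_on_inverse_scaled_factor assms(1-3))
    show "\<forall>\<^sub>F N in sequentially. \<forall>u\<in>sphere 0 \<rho>1. \<forall>w\<in>sphere 0 \<rho>2.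
       norm (scaled_factor N (n1 N) x1 u * inverse (scaled_factor N (n2 N) (x2 + 1) w) / (w - u))
         \<le> C1 * C2 / \<bar>\<rho>2 - \<rho>1\<bar>"
      using C1(2) C2(2)
    proof eventually_elim
      case (elim N)
      show ?case
      proof (intro ballI)
        fix u w :: complex assume uw: "u \<in> sphere 0 \<rho>1" "w \<in> sphere 0 \<rho>2"
        then have "\<bar>\<rho>2 - \<rho>1\<bar> \<le> norm (w - u)"
          using norm_triangle_ineq3[of w u] by simp
        then show "norm (scaled_factor N (n1 N) x1 u * inverse (scaled_factor N (n2 N) (x2 + 1) w) / (w - u))
         \<le> C1 * C2 / \<bar>\<rho>2 - \<rho>1\<bar>"
          unfolding norm_divide norm_mult
          using elim uw C1(1) C2(1) assms(3)
          by (intro frac_le mult_mono) (auto simp del: norm_inverse mem_sphere)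
      qed
    qed
    show "(\<lambda>N. scaled_factor N (n1 N) x1 u * inverse (scaled_factor N (n2 N) (x2 + 1) w) / (w - u))
       \<longlonglongrightarrow> limit_factor s1 x1 u * inverse (limit_factor s2 (x2 + 1) w) / (w - u)"
      if "u \<in> sphere 0 \<rho>1" "w \<in> sphere 0 \<rho>2" for u w
      using that assms
      by (intro tendsto_divide tendsto_mult tendsto_inverse tendsto_const scaled_factor_tendsto)
         (auto simp: limit_factor_nonzero)
  qed
qed

text \<open>Only \<open>u\<close> is rescaled here; its differential and factor give
  \<open>lam powi (x1 + 1)\<close>. What remains is \<open>lam powi (x2 + 1)\<close>, which blows up
  when \<open>x2 < - 1\<close>.\<close>

lemma scaled_outer_double:
  "of_real (lam N) powi (x2 - x1) *
     contour_integral (circlepath 0 (lam N * \<rho>)) (\<lambda>u. contour_integral (circlepath z q)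
       (\<lambda>w. plancherel_factor (gm N) (gp N) n1 x1 u * B w / (w - u)))
   = contour_integral (circlepath 0 \<rho>) (\<lambda>u. contour_integral (circlepath z q)
       (\<lambda>w. of_real (lam N) powi (x2 + 1) * (scaled_factor N n1 x1 u * B w / (w - of_real (lam N) * u))))"
proof -
  define l where "l = complex_of_real (lam N)"
  have "l \<noteq> 0" using lam_pos[of N] by (simp add: l_def)
  have eq: "plancherel_factor (gm N) (gp N) n1 x1 (l * u) * B w / (w - l * u)
      = l powi x1 * (scaled_factor N n1 x1 u * B w / (w - l * u))" for u w
    by (simp add: l_def plancherel_factor_scale)
  have "l powi (x2 - x1) * (l * l powi x1) = l powi (x2 + 1)"
    using \<open>l \<noteq> 0\<close> power_int_add[of l "x2 - x1" "x1"] power_int_add[of l x2 1]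
    by (simp add: mult_ac)
  then show ?thesis
    unfolding contour_integral_circlepath_scale l_def[symmetric] eq contour_integral_cmult
    by (simp add: mult.assoc[symmetric])
qed

text \<open>On \<open>\<bar>w - 1\<bar> = 2\<close> the factor \<open>(1 - w) ^ (- n2)\<close> decays exponentially in \<open>1 / lam\<close>,
  which beats the power of \<open>lam\<close> produced by the scaling.\<close>
lemma scaled_outer_double_tendsto:
  assumes "0 < \<rho>" "0 < s2"
    and "(\<lambda>N. lam N * real (n1 N)) \<longlonglongrightarrow> s1" "(\<lambda>N. lam N * real (n2 N)) \<longlonglongrightarrow> s2"
  shows "(\<lambda>N. of_real (lam N) powi (x2 - x1) *
     contour_integral (circlepath 0 (lam N * \<rho>)) (\<lambda>u. contour_integral (circlepath 1 2)
       (\<lambda>w. plancherel_factor (gm N) (gp N) (n1 N) x1 u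
         * inverse (plancherel_factor (gm N) (gp N) (n2 N) (x2 + 1) w) / (w - u)))) \<longlonglongrightarrow> 0"
proof -
  obtain C where C: "0 \<le> C" "\<forall>\<^sub>F N in sequentially. \<forall>u\<in>sphere 0 \<rho>.
        norm (scaled_factor N (n1 N) x1 u) \<le> C \<and> norm (inverse (scaled_factor N (n1 N) x1 u)) \<le> C"
    using scaled_factor_bound[OF assms(1,3)] .
  have w_bounds: "1 \<le> norm w" "norm w \<le> 3" "norm (1 - w) = 2" if "w \<in> sphere 1 2" for w :: complex
    using that norm_triangle_ineq2[of "1 - w" 1] norm_triangle_ineq4[of 1 "1 - w"]
    by (auto simp: dist_norm)
  have "compact ((\<lambda>w::complex. inverse (w powi (x2 + 1))) ` sphere 1 2)"
    by (intro compact_continuous_image continuous_intros compact_sphere) (use w_bounds in auto)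
  from compact_imp_bounded[OF this] obtain M
    where "\<forall>y\<in>(\<lambda>w::complex. inverse (w powi (x2 + 1))) ` sphere 1 2. norm y \<le> M"
    unfolding bounded_iff ..
  then have M: "norm (inverse (w powi (x2 + 1))) \<le> M" if "w \<in> sphere 1 2" for w :: complex
    using imageI[OF that] by (rule bspec)
  \<comment> \<open>The point 3 lies on the circle of radius 2 about 1.\<close>
  have "0 \<le> M" using order_trans[OF norm_ge_zero M[of 3]] by (simp add: dist_norm)
  \<comment> \<open>\<open>C\<close> bounds the factor in \<open>u\<close>; the exponential uses
    \<open>norm w \<le> 3\<close> and \<open>norm (inverse w) \<le> 1\<close>; the final 2 bounds
    the inverse of \<open>w - lam N * u\<close>, whose norm is eventually at least
    \<open>1/2\<close>.\<close>
  define b where "b N = lam N powi (x2 + 1) * (C * (exp (gm N * 3 + gp N) * M * (1 / 2 ^ n2 N)) * 2)" for N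
  have b_lim: "b \<longlonglongrightarrow> 0"
  proof -
    have inv_lam: "filterlim (\<lambda>N. inverse (lam N)) at_top sequentially"
      using lam_lim lam_pos by (intro filterlim_inverse_at_top) auto
    have "filterlim (\<lambda>N. lam N * real (n2 N) * inverse (lam N)) at_top sequentially"
      by (rule filterlim_tendsto_pos_mult_at_top[OF assms(4,2) inv_lam])
    then have "filterlim (\<lambda>N. real (n2 N)) at_top sequentially"
      using lam_pos by (simp add: field_simps less_imp_neq[symmetric])
    then have n2: "filterlim n2 at_top sequentially"
      by (simp add: filterlim_sequentially_iff_filterlim_real)
    have "gp \<longlonglongrightarrow> 0"
      using tendsto_mult[OF gp_lim lam_lim] lam_pos by (simp add: less_imp_neq[symmetric])
    \<comment> \<open>The power of \<open>lam\<close> is traded for a power of \<open>n2\<close>: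
      since \<open>lam N * n2 N\<close> tends to the nonzero \<open>s2\<close>, only a power of
      \<open>n2 N\<close> divided by \<open>2 ^ n2 N\<close> is left to estimate.\<close>
    then have "(\<lambda>N. (lam N * real (n2 N)) powi (x2 + 1) * (real (n2 N) powi (- (x2 + 1)) / 2 ^ n2 N)
         * (C * (exp (gm N * 3 + gp N) * M) * 2))
       \<longlonglongrightarrow> s2 powi (x2 + 1) * 0 * (C * (exp (0 * 3 + 0) * M) * 2)"
      using assms(2)
      by (intro tendsto_mult tendsto_power_int assms(4) tendsto_exp tendsto_add tendsto_const gm_lim
          filterlim_compose[OF tendsto_real_power_int_div_exp n2]) auto
    then have "(\<lambda>N. (lam N * real (n2 N)) powi (x2 + 1) * (real (n2 N) powi (- (x2 + 1)) / 2 ^ n2 N)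
         * (C * (exp (gm N * 3 + gp N) * M) * 2)) \<longlonglongrightarrow> 0" by simp
    moreover have "\<forall>\<^sub>F N in sequentially. (lam N * real (n2 N)) powi (x2 + 1)
        * (real (n2 N) powi (- (x2 + 1)) / 2 ^ n2 N) * (C * (exp (gm N * 3 + gp N) * M) * 2) = b N"
      using n2[unfolded filterlim_at_top, rule_format, of 1]
    proof eventually_elim
      case (elim N)
      then have 1: "real (n2 N) powi (x2 + 1) * real (n2 N) powi (- (x2 + 1)) = 1"
        by (simp only: power_int_minus) simp
      have "(lam N * real (n2 N)) powi (x2 + 1) * (real (n2 N) powi (- (x2 + 1)) / 2 ^ n2 N)
            * (C * (exp (gm N * 3 + gp N) * M) * 2)
          = (real (n2 N) powi (x2 + 1) * real (n2 N) powi (- (x2 + 1))) * b N"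
        by (simp only: b_def power_int_mult_distrib divide_inverse mult_ac mult_1)
      then show ?case by (simp only: 1 mult_1)
    qed
    ultimately show ?thesis by (blast intro: Lim_transform_eventually)
  qed
  let ?f = "\<lambda>N u w. of_real (lam N) powi (x2 + 1) * (scaled_factor N (n1 N) x1 u
       * inverse (plancherel_factor (gm N) (gp N) (n2 N) (x2 + 1) w) / (w - of_real (lam N) * u))"
  have f_le: "\<forall>\<^sub>F N in sequentially. \<forall>u\<in>sphere 0 \<rho>. \<forall>w\<in>sphere 1 2. norm (?f N u w) \<le> b N"
    using C(2) lam_mult_less[of "1/2" \<rho>, simplified]
  proof eventually_elim
    case (elim N)
    show ?case
    proof (intro ballI)
      fix u w :: complex assume uw: "u \<in> sphere 0 \<rho>" "w \<in> sphere 1 2"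
      note w = w_bounds[OF uw(2)]
      let ?e = "of_real (gm N) * w + of_real (gp N) * inverse w"
      have "norm (- ?e) \<le> gm N * 3 + gp N"
        unfolding norm_minus_cancel
        using w gm_nonneg[of N] gp_nonneg[of N] mult_left_mono[of "inverse (norm w)" 1 "gp N"]
        by (intro norm_triangle_le add_mono)
           (auto simp: norm_mult norm_inverse inverse_le_1_iff intro!: mult_left_mono)
      then have "norm (inverse (exp ?e)) \<le> exp (gm N * 3 + gp N)"
        unfolding exp_minus[symmetric] using norm_exp[of "- ?e"] by (meson exp_le_cancel_iff order_trans)
      moreover have "norm (inverse ((1 - w) ^ n2 N)) \<le> 1 / 2 ^ n2 N"
        using w by (simp add: norm_inverse norm_power divide_inverse)
      ultimately have P: "norm (inverse (plancherel_factor (gm N) (gp N) (n2 N) (x2 + 1) w))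
          \<le> exp (gm N * 3 + gp N) * M * (1 / 2 ^ n2 N)"
        unfolding plancherel_factor_def inverse_mult_distrib norm_mult
        using M[OF uw(2)] \<open>0 \<le> M\<close> by (intro mult_mono) auto
      have "1 / 2 \<le> norm (w - of_real (lam N) * u)"
        using norm_triangle_ineq2[of w "of_real (lam N) * u"] w uw elim(2) lam_pos[of N]
        by (simp add: norm_mult)
      then have "norm (inverse (w - of_real (lam N) * u)) \<le> 2"
        using le_imp_inverse_le[of "1/2" "norm (w - of_real (lam N) * u)"] by (simp add: norm_inverse)
      moreover have "norm (scaled_factor N (n1 N) x1 u) \<le> C"
        using elim uw by blast
      moreover have "norm (complex_of_real (lam N) powi (x2 + 1)) = lam N powi (x2 + 1)"
        using lam_pos[of N] by (simp add: norm_power_int)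
      ultimately show "norm (?f N u w) \<le> b N"
        unfolding b_def divide_inverse[of _ "w - of_real (lam N) * u"] norm_mult
        using P C(1) \<open>0 \<le> M\<close> lam_pos[of N]
        by (intro mult_mono) (auto intro!: mult_nonneg_nonneg zero_le_power_int simp del: norm_inverse)
    qed
  qed
  have "(\<lambda>N. contour_integral (circlepath 0 \<rho>) (\<lambda>u. contour_integral (circlepath 1 2) (?f N u)))
      \<longlonglongrightarrow> contour_integral (circlepath 0 \<rho>) (\<lambda>u. contour_integral (circlepath 1 2) (\<lambda>w. 0))"
  proof (rule tendsto_contour_integral_circlepath_double[where B = 1])
    show "\<forall>\<^sub>F N in sequentially. continuous_on (sphere 0 \<rho> \<times> sphere 1 2) (\<lambda>(u, w). ?f N u w)"
      using lam_mult_less[of "1/2" \<rho>, simplified]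
    proof eventually_elim
      case (elim N)
      have 1: "continuous_on (sphere 1 2) (\<lambda>w. inverse (plancherel_factor (gm N) (gp N) (n2 N) (x2 + 1) w))"
        by (intro holomorphic_on_imp_continuous_on
              holomorphic_on_subset[OF holomorphic_inverse_plancherel_factor]) (use w_bounds in fastforce)
      have 2: "w \<noteq> of_real (lam N) * u" if "u \<in> sphere 0 \<rho>" "w \<in> sphere 1 2" for u w :: complex
        using that w_bounds[of w] elim lam_pos[of N] by (auto simp: norm_mult)
      show ?case
        unfolding case_prod_unfold
        by (intro continuous_intros continuous_on_compose2[OF 1]
            continuous_on_compose2[OF continuous_on_scaled_factor[OF assms(1)]]) (use 2 in auto)
    qed
    show "\<forall>\<^sub>F N in sequentially. \<forall>u\<in>sphere 0 \<rho>. \<forall>w\<in>sphere 1 2. norm (?f N u w) \<le> 1"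
      using f_le order_tendstoD(2)[OF b_lim zero_less_one]
      by eventually_elim (force simp del: mem_sphere)
    show "(\<lambda>N. ?f N u w) \<longlonglongrightarrow> 0" if "u \<in> sphere 0 \<rho>" "w \<in> sphere 1 2" for u w
      by (rule Lim_null_comparison[OF _ b_lim]) (use f_le that in \<open>force elim: eventually_mono\<close>)
  qed (use assms in auto)
  then show ?thesis
    unfolding scaled_outer_double by simp
qed

text \<open>In the open unit disc the integrand is singular only at 0, so the radius
  \<open>r\<close> may be replaced by \<open>lam N * \<rho>\<close> once this is below 1. Rescaling
  then turns \<open>(1 - z) ^ m N\<close> into a power whose inverse tends to
  \<open>exp (s * z)\<close>.\<close>

lemma scaled_single_tendsto:
  assumes "0 < r" "r < 1" "0 < \<rho>" "(\<lambda>N. lam N * real (m N)) \<longlonglongrightarrow> s"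
  shows "(\<lambda>N. of_real (lam N) powi (- k) * contour_integral (circlepath 0 r) (\<lambda>z. z powi (k - 1) / (1 - z) ^ m N))
     \<longlonglongrightarrow> contour_integral (circlepath 0 \<rho>) (\<lambda>z. exp (of_real s * z) * z powi (k - 1))"
proof -
  have eq: "\<forall>\<^sub>F N in sequentially.
      contour_integral (circlepath 0 \<rho>) (\<lambda>z::complex. inverse ((1 - of_real (lam N) * z) ^ m N) * z powi (k - 1))
      = of_real (lam N) powi (- k) * contour_integral (circlepath 0 r) (\<lambda>z. z powi (k - 1) / (1 - z) ^ m N)"
    using lam_mult_less[of 1 \<rho>, simplified]
  proof eventually_elim
    case (elim N)
    define l where "l = complex_of_real (lam N)"
    have "l \<noteq> 0" using lam_pos[of N] by (simp add: l_def)
    let ?h = "\<lambda>z::complex. z powi (k - 1) / (1 - z) ^ m N"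
    have res: "contour_integral (circlepath 0 q) ?h = 2 * of_real pi * \<i> * residue ?h 0"
      if "0 < q" "q < 1" for q
    proof -
      have "?h holomorphic_on - {0, 1}"
        by (intro holomorphic_intros) auto
      moreover have "{0, 1} \<inter> ball 0 q = {0::complex}" "{0, 1} \<inter> sphere (0::complex) q = {}"
        using that by auto
      ultimately show ?thesis
        using contour_integral_circlepath_eq_sum_residues[of "{0, 1}" ?h q 0] that
        by (simp only: finite.intros) simp
    qed
    have scale: "(l * z) powi (k - 1) / (1 - l * z) ^ m N
        = l powi (k - 1) * (inverse ((1 - l * z) ^ m N) * z powi (k - 1))" for z
      by (simp add: power_int_mult_distrib divide_inverse mult_ac)
    have "contour_integral (circlepath 0 r) ?h = contour_integral (circlepath 0 (lam N * \<rho>)) ?h"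
      using res[of r] res[of "lam N * \<rho>"] assms elim lam_pos[of N] by simp
    moreover have "l powi (- k) * (l * l powi (k - 1)) = 1"
      using \<open>l \<noteq> 0\<close> power_int_add[of l 1 "k - 1"] by (simp add: power_int_minus field_simps)
    ultimately show ?case
      unfolding l_def[symmetric] contour_integral_circlepath_scale scale contour_integral_cmult
      by (simp add: mult.assoc[symmetric])
  qed
  have "(\<lambda>N. contour_integral (circlepath 0 \<rho>)
          (\<lambda>z::complex. inverse ((1 - of_real (lam N) * z) ^ m N) * z powi (k - 1)))
     \<longlonglongrightarrow> contour_integral (circlepath 0 \<rho>) (\<lambda>z. exp (of_real s * z) * z powi (k - 1))"
  proof (rule tendsto_contour_integral_circlepath[OF assms(3)])
    show "\<forall>\<^sub>F N in sequentially. continuous_on (sphere 0 \<rho>)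
       (\<lambda>z::complex. inverse ((1 - of_real (lam N) * z) ^ m N) * z powi (k - 1))"
      using lam_mult_less[of 1 \<rho>, simplified]
    proof eventually_elim
      case (elim N)
      have "1 - of_real (lam N) * z \<noteq> 0" if "norm z = \<rho>" for z :: complex
      proof
        assume "1 - of_real (lam N) * z = 0"
        then have "norm (of_real (lam N) * z) = 1" by simp
        with that elim lam_pos[of N] show False by (simp add: norm_mult)
      qed
      then show ?case by (intro continuous_intros) (use assms(3) in auto)
    qed
    show "\<forall>\<^sub>F N in sequentially. \<forall>z\<in>sphere (0::complex) \<rho>.
       norm (inverse ((1 - of_real (lam N) * z) ^ m N) * z powi (k - 1))
         \<le> exp (2 * ((s + 1) * \<rho>)) * \<rho> powi (k - 1)"
      using lam_mult_less[of "1/2" \<rho>, simplified] order_tendstoD(2)[OF assms(4), of "s + 1", simplified]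
    proof eventually_elim
      case (elim N)
      show ?case
      proof
        fix z :: complex assume z: "z \<in> sphere 0 \<rho>"
        have "norm (inverse ((1 - of_real (lam N) * z) ^ m N)) \<le> exp (2 * (lam N * real (m N) * \<rho>))"
          using norm_inverse_one_minus_power_le[of "lam N" z "m N"] lam_pos[of N] elim(1) z by simp
        also have "\<dots> \<le> exp (2 * ((s + 1) * \<rho>))"
          using elim(2) assms(3) by (simp add: mult_right_mono)
        finally show "norm (inverse ((1 - of_real (lam N) * z) ^ m N) * z powi (k - 1))
         \<le> exp (2 * ((s + 1) * \<rho>)) * \<rho> powi (k - 1)"
          unfolding norm_mult using z assms(3)
          by (intro mult_mono) (auto simp: norm_power_int zero_le_power_int)
      qed
    qed
    show "(\<lambda>N. inverse ((1 - of_real (lam N) * z) ^ m N) * z powi (k - 1))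
       \<longlonglongrightarrow> exp (of_real s * z) * z powi (k - 1)" for z :: complex
      using tendsto_inverse[OF tendsto_one_minus_power[OF lam_lim lam_pos assms(4), of z]]
      by (intro tendsto_mult_right) (simp add: exp_minus)
  qed
  with eq show ?thesis by (blast intro: Lim_transform_eventually)
qed

end

section \<open>Convergence of the rescaled kernel\<close>

text \<open>\<open>K_kernel\<close> has \<open>u - w\<close> where the deformation has
  \<open>w - u\<close>; the sign reverses the difference, so the small circles enter with a
  plus.\<close>

lemma K_kernel_eq_deform:
  assumes "0 < \<rho>1" "\<rho>1 < \<rho>2" "\<rho>2 < 1" "\<rho>1 < r" "r < 1" "0 < e" "e < 1 - r"
  shows "K_kernel r e a b n1 x1 n2 x2 =
     - (if n1 < n2 then
          1 / (2 * of_real pi * \<i>) *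
          contour_integral (circlepath 0 r) (\<lambda>z. z powi (x1 - x2 - 1) / (1 - z) ^ (n2 - n1))
        else 0)
     + (1 / (2 * of_real pi * \<i>)) ^ 2 *
       (contour_integral (circlepath 0 \<rho>1) (\<lambda>u. contour_integral (circlepath 0 \<rho>2)
          (\<lambda>w. plancherel_factor a b n1 x1 u * inverse (plancherel_factor a b n2 (x2 + 1) w) / (w - u)))
      - contour_integral (circlepath 0 \<rho>1) (\<lambda>u. contour_integral (circlepath 1 2)
          (\<lambda>w. plancherel_factor a b n1 x1 u * inverse (plancherel_factor a b n2 (x2 + 1) w) / (w - u))))"
proof -
  have eq: "(exp (of_real a * u + of_real b * inverse u) * u powi x1 * (1 - u) ^ n1) /
           (exp (of_real a * w + of_real b * inverse w) * w powi (1 + x2) * (1 - w) ^ n2) *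
           (1 / (u - w))
     = (-1) * (plancherel_factor a b n1 x1 u * inverse (plancherel_factor a b n2 (x2 + 1) w) / (w - u))"
    for u w
  proof -
    have "1 / (u - w) = - (1 / (w - u))"
      using minus_diff_eq[of w u] by (metis minus_divide_right)
    then show ?thesis
      by (simp add: plancherel_factor_def divide_inverse add.commute)
  qed
  show ?thesis
    unfolding K_kernel_def eq contour_integral_cmult
      contour_integral_Cauchy_kernel_deform[OF holomorphic_plancherel_factor
        holomorphic_inverse_plancherel_factor assms]
    by (simp add: algebra_simps)
qed

context plancherel_scaling
begin

text \<open>Everything depends on the single integral. For \<open>s2 < s1\<close> it is eventually
  absent; for \<open>s1 < s2\<close> it is eventually present, and its limit moves the
  \<open>w\<close>-contour inside. For \<open>s1 = s2\<close> it tends to 0 if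
  \<open>x1 \<noteq> x2\<close>, and otherwise is eventually absent by
  \<open>coincident\<close>.\<close>

lemma scaled_K_kernel_tendsto:
  assumes contours: "0 < r" "r < 1" "0 < e" "e < 1 - r" "0 < r1" "r1 < r2"
    and n1: "(\<lambda>N. lam N * real (n1 N)) \<longlonglongrightarrow> s1"
    and n2: "(\<lambda>N. lam N * real (n2 N)) \<longlonglongrightarrow> s2" and "0 < s2"
    and coincident: "s1 = s2 \<Longrightarrow> x1 = x2 \<Longrightarrow> \<forall>\<^sub>F N in sequentially. n1 N = n2 N"
  shows "(\<lambda>N. of_real (lam N) powi (x2 - x1) * K_kernel r e (gm N) (gp N) (n1 N) x1 (n2 N) x2)
           \<longlonglongrightarrow> J_kernel r1 r2 s2 x2 s1 x1"
proof -
  let ?c = "1 / (2 * of_real pi * \<i>) :: complex"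
  let ?l = "\<lambda>N. of_real (lam N) powi (x2 - x1) :: complex"
  let ?S = "\<lambda>N. contour_integral (circlepath 0 r) (\<lambda>z. z powi (x1 - x2 - 1) / (1 - z) ^ (n2 N - n1 N))"
  let ?T = "\<lambda>N. ?c * (?l N * ?S N)"
  let ?D = "\<lambda>N q v r'. contour_integral (circlepath 0 (lam N * q)) (\<lambda>u. contour_integral (circlepath v r')
          (\<lambda>w. plancherel_factor (gm N) (gp N) (n1 N) x1 u
             * inverse (plancherel_factor (gm N) (gp N) (n2 N) (x2 + 1) w) / (w - u)))"
  let ?R = "\<lambda>q. contour_integral (circlepath 0 q)
             (\<lambda>z. exp (of_real (s2 - s1) * z) * z powi (x1 - x2 - 1))"
  \<comment> \<open>The limit \<open>E\<close> of the single term and the radii stay free, since the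
    two contour orders need different choices.\<close>
  have main: "(\<lambda>N. ?l N * K_kernel r e (gm N) (gp N) (n1 N) x1 (n2 N) x2)
        \<longlonglongrightarrow> - E + ?c ^ 2 * limit_double q1 q2 s2 x2 s1 x1"
    if q: "0 < q1" "q1 < q2" and E: "(\<lambda>N. if n1 N < n2 N then ?T N else 0) \<longlonglongrightarrow> E" for q1 q2 E
  proof -
    have "\<forall>\<^sub>F N in sequentially.
        - (if n1 N < n2 N then ?T N else 0) + ?c ^ 2 * (?l N * ?D N q1 0 (lam N * q2) - ?l N * ?D N q1 1 2)
      = ?l N * K_kernel r e (gm N) (gp N) (n1 N) x1 (n2 N) x2"
      using lam_mult_less[of 1 q2, simplified] lam_mult_less[of r q1, OF \<open>0 < r\<close>]
    proof eventually_elim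
      case (elim N)
      have "0 < lam N * q1" "lam N * q1 < lam N * q2"
        using q lam_pos[of N] by auto
      from K_kernel_eq_deform[OF this elim contours(2-4)] show ?case
        by (simp only: if_distrib[of "\<lambda>x. ?l N * x"] if_distrib[of uminus] mult_zero_right
              distrib_left right_diff_distrib mult_minus_right mult_ac split: if_split) simp
    qed
    moreover have "(\<lambda>N. - (if n1 N < n2 N then ?T N else 0)
          + ?c ^ 2 * (?l N * ?D N q1 0 (lam N * q2) - ?l N * ?D N q1 1 2))
        \<longlonglongrightarrow> - E + ?c ^ 2 * (limit_double q1 q2 s2 x2 s1 x1 - 0)"
      unfolding scaled_double
      using q \<open>0 < s2\<close>
      by (intro tendsto_add tendsto_minus E tendsto_mult_left tendsto_diff
            scaled_double_tendsto[OF _ _ _ n1 n2] scaled_outer_double_tendsto[OF _ _ n1 n2]) auto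
    ultimately show ?thesis
      by (simp add: Lim_transform_eventually)
  qed
  have T: "?T \<longlonglongrightarrow> ?c * ?R q" if "0 < q" "s1 \<le> s2" for q
  proof -
    \<comment> \<open>The maximum with 0 reproduces truncated subtraction; for
      \<open>s1 = s2\<close> the sign of \<open>n2 N - n1 N\<close> may keep changing.\<close>
    have "(\<lambda>N. max (lam N * real (n2 N) - lam N * real (n1 N)) 0) \<longlonglongrightarrow> max (s2 - s1) 0"
      by (intro tendsto_max tendsto_diff n1 n2 tendsto_const)
    moreover have "max (lam N * real (n2 N) - lam N * real (n1 N)) 0 = lam N * real (n2 N - n1 N)" for N
      using lam_pos[of N] by (cases "n1 N \<le> n2 N") (auto simp: max_def of_nat_diff algebra_simps)
    ultimately have "(\<lambda>N. lam N * real (n2 N - n1 N)) \<longlonglongrightarrow> s2 - s1"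
      using \<open>s1 \<le> s2\<close> by simp
    from tendsto_mult_left[OF scaled_single_tendsto[OF contours(1,2) \<open>0 < q\<close> this, of "x1 - x2"], of ?c]
    show ?thesis by simp
  qed
  show ?thesis
  proof (cases "s2 \<le> s1")
    case True
    have "(\<lambda>N. if n1 N < n2 N then ?T N else 0) \<longlonglongrightarrow> 0"
    proof (cases "s1 = s2 \<and> x1 \<noteq> x2")
      case True
      \<comment> \<open>Here the single integral itself tends to 0, so it does not matter how often
        \<open>n1 N < n2 N\<close> holds.\<close>
      then have "?R 1 = 0"
        using contour_integral_circlepath_power_int[of 1 "x1 - x2"] by simp
      with T[of 1] True have "?T \<longlonglongrightarrow> 0" by simp
      from tendsto_norm_zero[OF this] show ?thesis
        by (rule Lim_null_comparison[rotated]) auto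
    next
      case False
      have "\<forall>\<^sub>F N in sequentially. \<not> n1 N < n2 N"
      proof (cases "s1 = s2")
        case True
        with False show ?thesis by (auto intro: eventually_mono[OF coincident])
      next
        case False
        with \<open>s2 \<le> s1\<close> have "0 < s1 - s2" by simp
        from order_tendstoD(1)[OF tendsto_diff[OF n1 n2] this] show ?thesis
        proof eventually_elim
          case (elim N)
          then have "lam N * real (n2 N) < lam N * real (n1 N)" by simp
          then show ?case using lam_pos[of N] by simp
        qed
      qed
      then have "\<forall>\<^sub>F N in sequentially. 0 = (if n1 N < n2 N then ?T N else 0)"
        by eventually_elim simp
      then show ?thesis by (rule Lim_transform_eventually[OF tendsto_const])
    qed
    from main[OF contours(5,6) this] show ?thesis
      using True contours J_integral_eq_limit_double[of r1 r2 s2 x2 s1 x1]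
      by (simp add: J_kernel_def)
  next
    case False
    have "\<forall>\<^sub>F N in sequentially. n1 N < n2 N"
    proof -
      from False have "0 < s2 - s1" by simp
      from order_tendstoD(1)[OF tendsto_diff[OF n2 n1] this] show ?thesis
      proof eventually_elim
        case (elim N)
        then have "lam N * real (n1 N) < lam N * real (n2 N)" by simp
        then show ?case using lam_pos[of N] by simp
      qed
    qed
    then have "\<forall>\<^sub>F N in sequentially. ?T N = (if n1 N < n2 N then ?T N else 0)"
      by eventually_elim simp
    from Lim_transform_eventually[OF T[of r2] this]
    have E: "(\<lambda>N. if n1 N < n2 N then ?T N else 0) \<longlonglongrightarrow> ?c * ?R r2"
      using contours False by simp
    have "J_kernel r1 r2 s2 x2 s1 x1 = ?c ^ 2 * limit_double r2 r1 s2 x2 s1 x1"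
      using False contours J_integral_eq_limit_double[of r2 r1 s2 x2 s1 x1]
      by (simp add: J_kernel_def)
    \<comment> \<open>In this case \<open>J_kernel\<close> has \<open>u\<close> on radius
      \<open>r2\<close> and \<open>w\<close> inside; \<open>r2 + 1\<close> is just some larger
      radius to which the \<open>w\<close>-circle is moved.\<close>
    also have "\<dots> = - (?c * ?R r2) + ?c ^ 2 * limit_double r2 (r2 + 1) s2 x2 s1 x1"
    proof -
      have "limit_double r2 r1 s2 x2 s1 x1
          = limit_double r2 (r2 + 1) s2 x2 s1 x1 - 2 * of_real pi * \<i> * ?R r2"
        using contours by (intro limit_double_cross) auto
      moreover have "?c ^ 2 * (2 * of_real pi * \<i>) = ?c"
        by (simp add: power2_eq_square)
      ultimately show ?thesis
        by (simp only: right_diff_distrib mult.assoc[symmetric]) simp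
    qed
    finally show ?thesis
      using main[OF _ _ E, of r2 "r2 + 1"] contours by simp
  qed
qed

end

section \<open>The limit of the determinants\<close>

text \<open>If \<open>t i = t j\<close>, \<open>x i = x j\<close> and yet
  \<open>n N i < n N j\<close> for infinitely many \<open>N\<close>, then along these
  \<open>N\<close> the single integral would contribute a term tending to 1 that
  \<open>J_kernel\<close> lacks; \<open>coincident\<close> excludes this. By \<open>t_pos\<close>
  each \<open>n N j\<close> grows linearly, which gives the exponential decay on the large
  circle.\<close>

theorem theorem4p1:
  fixes x :: "'k::finite \<Rightarrow> int"
    and t :: "'k \<Rightarrow> real"
    and n :: "nat \<Rightarrow> 'k \<Rightarrow> nat"
    and gm gp :: "nat \<Rightarrow> real"
    and a r e r1 r2 :: real
  assumes K_contours: "0 < r" "r < 1" "0 < e" "e < 1 - r"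
    and J_contours: "0 < r1" "r1 < r2"
    and n_pos: "\<And>N j. 0 < n N j"
    and gm_nonneg: "\<And>N. 0 \<le> gm N"
    and gp_nonneg: "\<And>N. 0 \<le> gp N"
    and t_pos: "\<And>j. 0 < t j"
    and n_lim: "\<And>j. (\<lambda>N. real (n N j) / real N) \<longlonglongrightarrow> t j"
    and a_pos: "0 < a"
    and gm_lim: "(\<lambda>N. gm N * real N) \<longlonglongrightarrow> a"
    and gp_lim: "(\<lambda>N. gp N * real N) \<longlonglongrightarrow> a"
    and coincident: "\<And>i j. t i = t j \<Longrightarrow> x i = x j \<Longrightarrow> \<forall>\<^sub>F N in sequentially. n N i = n N j"
  shows "(\<lambda>N. det (\<chi> i j. K_kernel r e (gm N) (gp N) (n N i) (x i) (n N j) (x j)) :: complex)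
           \<longlonglongrightarrow> det (\<chi> i j. J_kernel r1 r2 (a * t i) (x i) (a * t j) (x j))"
proof -
  \<comment> \<open>\<open>a / (N + 1)\<close> rather than \<open>a / N\<close>, so that the scale is positive at \<open>N = 0\<close> as well.\<close>
  define lam where "lam N = a / real (Suc N)" for N
  have ratio: "(\<lambda>N. real N / real (Suc N)) \<longlonglongrightarrow> 1"
    by (rule LIMSEQ_n_over_Suc_n)
  have lam_lim: "lam \<longlonglongrightarrow> 0"
    unfolding lam_def using LIMSEQ_Suc[OF lim_const_over_n[of a]] by simp
  interpret plancherel_scaling gm gp lam
  proof
    show "0 < lam N" for N using a_pos by (simp add: lam_def)
    have "(\<lambda>N. gm N * real N * (1 / real N)) \<longlonglongrightarrow> a * 0"
      by (intro tendsto_mult gm_lim lim_1_over_n)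
    moreover have "\<forall>\<^sub>F N in sequentially. gm N * real N * (1 / real N) = gm N"
      using eventually_gt_at_top[of 0] by eventually_elim simp
    ultimately show "gm \<longlonglongrightarrow> 0" by (simp add: Lim_transform_eventually)
    have "(\<lambda>N. gp N * real N / a / (real N / real (Suc N))) \<longlonglongrightarrow> a / a / 1"
      using a_pos by (intro tendsto_divide gp_lim ratio tendsto_const) auto
    moreover have "\<forall>\<^sub>F N in sequentially. gp N * real N / a / (real N / real (Suc N)) = gp N / lam N"
      using eventually_gt_at_top[of 0] by eventually_elim (simp add: lam_def)
    ultimately show "(\<lambda>N. gp N / lam N) \<longlonglongrightarrow> 1" using a_pos by (simp add: Lim_transform_eventually)
  qed (use gm_nonneg gp_nonneg lam_lim in auto)
  have n_scaled: "(\<lambda>N. lam N * real (n N j)) \<longlonglongrightarrow> a * t j" for j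
  proof -
    have "(\<lambda>N. a * (real (n N j) / real N) * (real N / real (Suc N))) \<longlonglongrightarrow> a * t j * 1"
      by (intro tendsto_mult tendsto_const n_lim ratio)
    moreover have "\<forall>\<^sub>F N in sequentially.
        a * (real (n N j) / real N) * (real N / real (Suc N)) = lam N * real (n N j)"
      using eventually_gt_at_top[of 0] by eventually_elim (simp add: lam_def)
    ultimately show ?thesis by (simp add: Lim_transform_eventually)
  qed
  let ?K = "\<lambda>N i j. K_kernel r e (gm N) (gp N) (n N i) (x i) (n N j) (x j)"
  let ?J = "\<lambda>i j. J_kernel r1 r2 (a * t i) (x i) (a * t j) (x j)"
  let ?l = "\<lambda>N. complex_of_real (lam N)"
  \<comment> \<open>Entrywise the limit has its two points interchanged, so the transposed matrix
    appears first.\<close>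
  have "(\<lambda>N. det (\<chi> i j. ?l N powi (x j - x i) * ?K N i j)) \<longlonglongrightarrow> det (\<chi> i j. ?J j i)"
  proof (rule tendsto_det)
    show "(\<lambda>N. ?l N powi (x j - x i) * ?K N i j) \<longlonglongrightarrow> ?J j i" for i j
      using a_pos t_pos[of j] coincident[of i j]
      by (intro scaled_K_kernel_tendsto K_contours J_contours n_scaled) auto
  qed
  moreover have "det (\<chi> i j. ?l N powi (x j - x i) * ?K N i j) = det (\<chi> i j. ?K N i j)" for N
  proof -
    have "?l N \<noteq> 0" using lam_pos[of N] by simp
    \<comment> \<open>The prefactor is a quotient of a row factor and a column factor, the form
      required by \<open>det_conjugate\<close>.\<close>
    then have "?l N powi (x j - x i) * ?K N i j = ?l N powi (- x i) * ?K N i j / ?l N powi (- x j)" for i j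
      using power_int_diff[of "?l N" "- x i" "- x j"] by simp
    then show ?thesis
      using det_conjugate[of "\<lambda>i. ?l N powi (- x i)" "\<chi> i j. ?K N i j"] \<open>?l N \<noteq> 0\<close> by simp
  qed
  moreover have "det (\<chi> i j. ?J j i) = det (\<chi> i j. ?J i j)"
    using det_transpose[of "\<chi> i j. ?J i j"] by (simp add: transpose_def)
  ultimately show ?thesis by simp
qed

end
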